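(* Let $r$ be an integer and let $u\in\mathbb{Z}[x]$ be nilpotent at $r$. Then the nilpotency index of $u$ at $r$ is at most $|r|+2$. Moreover, if $|r|\ge 3$, then the nilpotency index of $u$ at $r$ is at most $|r|$.
   Context: $\mathbb{N}$ is the set of positive integers. For $u\in\mathbb{Z}[x]$ and $n\in\mathbb{N}$, $u^{(n)}$ denotes the $n$-fold composition $u\circ\cdots\circ u$. For $r\in\mathbb{Z}$, $u$ is called nilpotent at $r$ if there is $n\in\mathbb{N}$ with $u^{(n)}(r)=0$; the smallest such $n$ is called the (nilpotency) index of $u$ at $r$. The zero polynomial is nilpotent at every $r$ with index $1$. *)

theory Defs
  imports "HOL-Computational_Algebra.Polynomial"
begin

text \<open>The \<open>n\<close>-fold composition of \<open>u\<close> with itself; the value at \<open>n = 0\<close> is the identity polynomial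
  \<open>x\<close>.\<close>
definition poly_iter :: "int poly \<Rightarrow> nat \<Rightarrow> int poly" where
  "poly_iter u n = ((\<circ>\<^sub>p) u ^^ n) [:0, 1:]"

text \<open>Only positive iteration counts are allowed, so at \<open>r = 0\<close> the condition is not vacuous.\<close>
definition nilpotent_at :: "int poly \<Rightarrow> int \<Rightarrow> bool" where
  "nilpotent_at u r \<longleftrightarrow> (\<exists>n\<ge>1. poly (poly_iter u n) r = 0)"

text \<open>Unspecified unless \<open>u\<close> is nilpotent at \<open>r\<close>.\<close>
definition nilpotency_index :: "int poly \<Rightarrow> int \<Rightarrow> nat" where
  "nilpotency_index u r = (LEAST n. n \<ge> 1 \<and> poly (poly_iter u n) r = 0)"

lemma poly_poly_iter: "poly (poly_iter u n) r = (poly u ^^ n) r"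
  by (induction n) (simp_all add: poly_iter_def poly_pcompose)

end

theory Submission
  imports Defs
begin

text \<open>
  For \<open>r \<noteq> 0\<close>, let \<open>a\<^sub>0 = r, a\<^sub>1, \<dots>, a\<^sub>n = 0\<close> be the orbit of \<open>r\<close>. Its terms are distinct, and
  \<open>a\<^sub>i - a\<^sub>j\<close> divides \<open>a\<^sub>i\<^sub>+\<^sub>1 - a\<^sub>j\<^sub>+\<^sub>1\<close>; in particular the first step divides all later steps and
  hence all terms. Dividing by it, we may assume \<open>a\<^sub>1 = a\<^sub>0 + 1\<close>. Let \<open>k\<close> be the number of initial
  steps equal to \<open>1\<close>, and \<open>m\<close> the next step. Then \<open>\<bar>m\<bar> \<ge> 2\<close>, \<open>m\<close> divides \<open>a\<^sub>0 + k\<close>, and \<open>m - 1\<close> is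
  divisible by \<open>1, \<dots>, k\<close>. Induction applies to the orbit of \<open>a\<^sub>0 + k\<close> divided by \<open>m\<close>: an orbit
  starting towards zero has length at most \<open>\<bar>a\<^sub>0\<bar>\<close>, one starting away from zero obeys the bounds of
  the theorem. The finitely many parameters that escape the estimates are excluded since the last
  nonzero term \<open>c\<close> is a multiple of \<open>m\<close> distinct from the earlier terms, and \<open>c - a\<^sub>0\<close> divides \<open>a\<^sub>1\<close>.

  For \<open>r = 0\<close>, periodicity makes all steps equal up to sign. If the sign never changes, the orbit is
  an arithmetic progression, which does not return; if it changes, the period is at most \<open>2\<close>.
\<close>

section \<open>Integer sequences with the divisibility property of orbits\<close>

text \<open>Of a polynomial orbit only this divisibility is kept, since it survives passing to a
  tail and dividing all terms by a common factor. Nothing after index \<open>n\<close>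
  matters.\<close>

definition hits_zero :: "(nat \<Rightarrow> int) \<Rightarrow> nat \<Rightarrow> bool" where
  "hits_zero a n \<longleftrightarrow> 1 \<le> n \<and> a n = 0 \<and> (\<forall>i<n. a i \<noteq> 0) \<and>
     (\<forall>i<n. \<forall>j<n. a i - a j dvd a (Suc i) - a (Suc j))"

lemma hits_zeroD:
  assumes "hits_zero a n"
  shows "1 \<le> n" "a n = 0" "\<And>i. i < n \<Longrightarrow> a i \<noteq> 0"
    "\<And>i j. i < n \<Longrightarrow> j < n \<Longrightarrow> a i - a j dvd a (Suc i) - a (Suc j)"
  using assms by (auto simp: hits_zero_def)

text \<open>Difference zero divides only zero, so an equality of two terms propagates forward until
  the later one is \<open>a n = 0\<close>; the earlier one then vanishes too soon.\<close>

lemma hits_zero_distinct: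
  assumes h: "hits_zero a n" and "i < j" "j \<le> n"
  shows "a i \<noteq> a j"
proof
  assume eq: "a i = a j"
  have "a (i + t) = a (j + t)" if "j + t \<le> n" for t
    using that
  proof (induction t)
    case (Suc t)
    then show ?case using hits_zeroD(4)[OF h, of "i + t" "j + t"] \<open>i < j\<close> by simp
  qed (use eq in simp)
  from this[of "n - j"] have "a (i + (n - j)) = 0"
    using hits_zeroD(2)[OF h] \<open>j \<le> n\<close> by simp
  moreover have "i + (n - j) < n" using assms(2,3) by linarith
  ultimately show False using hits_zeroD(3)[OF h] by blast
qed

lemma hits_zero_shift:
  assumes h: "hits_zero a n" and "k < n"
  shows "hits_zero (\<lambda>i. a (k + i)) (n - k)"
  unfolding hits_zero_def
  using hits_zeroD(1-3)[OF h] hits_zeroD(4)[OF h, of "k + _" "k + _"] \<open>k < n\<close> by auto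

text \<open>Each step divides the next one; summing steps backwards from \<open>a n = 0\<close>
  reaches every term.\<close>

lemma first_step_dvd:
  assumes h: "hits_zero a n" and "i \<le> n"
  shows "a 1 - a 0 dvd a i"
proof -
  have d: "a 1 - a 0 dvd a (Suc j) - a j" if "j < n" for j
    using that
  proof (induction j)
    case (Suc j)
    then show ?case using hits_zeroD(4)[OF h, of "Suc j" j] by (meson Suc_lessD dvd_trans)
  qed simp
  show ?thesis using \<open>i \<le> n\<close>
  proof (induction i rule: inc_induct)
    case base
    then show ?case using hits_zeroD(2)[OF h] by simp
  next
    case (step j)
    have "a 1 - a 0 dvd a (Suc j) - (a (Suc j) - a j)"
      using step.IH d[OF step.hyps(2)] by (rule dvd_diff)
    then show ?case by simp
  qed
qed

lemma hits_zero_div: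
  assumes h: "hits_zero a n" and m: "m = a 1 - a 0"
  defines "b \<equiv> \<lambda>i. a i div m"
  shows "m \<noteq> 0" "hits_zero b n" "b 1 = b 0 + 1" "a 0 = m * b 0"
proof -
  show m0: "m \<noteq> 0" using hits_zero_distinct[OF h, of 0 1] hits_zeroD(1)[OF h] m by simp
  have ab: "a i = m * b i" if "i \<le> n" for i
    using first_step_dvd[OF h that] m by (simp add: b_def)
  show "a 0 = m * b 0" using ab by simp
  have b0: "b i \<noteq> 0" if "i < n" for i
    using hits_zeroD(3)[OF h that] ab[of i] that by auto
  have "b i - b j dvd b (Suc i) - b (Suc j)" if "i < n" "j < n" for i j
  proof -
    have "m * (b i - b j) dvd m * (b (Suc i) - b (Suc j))"
      using hits_zeroD(4)[OF h that] that ab by (simp add: right_diff_distrib)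
    then show ?thesis using m0 by simp
  qed
  then show "hits_zero b n"
    unfolding hits_zero_def using hits_zeroD(1,2)[OF h] b0 by (simp add: b_def)
  have "m * b 1 = m * (b 0 + 1)"
    using ab[of 0] ab[of 1] hits_zeroD(1)[OF h] m by (simp add: distrib_left)
  then show "b 1 = b 0 + 1" using m0 by simp
qed

text \<open>For the exceptional starts \<open>s\<close> below, \<open>s + 1\<close> is 2, 4 or 5 up
  to sign; these lists are the candidates for the last nonzero term \<open>c\<close>.\<close>

lemma diff_dvd_int_cases:
  fixes c s :: int
  shows "c - s dvd 2 \<Longrightarrow> c \<in> {s - 2, s - 1, s + 1, s + 2}"
    "c - s dvd 4 \<Longrightarrow> c \<in> {s - 4, s - 2, s - 1, s + 1, s + 2, s + 4}"
    "c - s dvd 5 \<Longrightarrow> c \<in> {s - 5, s - 1, s + 1, s + 5}"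
proof -
  show "c \<in> {s - 2, s - 1, s + 1, s + 2}" if "c - s dvd 2"
  proof -
    define d where "d = c - s"
    have "\<bar>d\<bar> \<le> 2" using dvd_imp_le_int[OF _ that] by (simp add: d_def)
    then have "d = -2 \<or> d = -1 \<or> d = 0 \<or> d = 1 \<or> d = 2"
      by presburger
    moreover have "c = s + d" "d dvd 2" using that by (simp_all add: d_def)
    ultimately show ?thesis by auto
  qed
  show "c \<in> {s - 4, s - 2, s - 1, s + 1, s + 2, s + 4}" if "c - s dvd 4"
  proof -
    define d where "d = c - s"
    have "\<bar>d\<bar> \<le> 4" using dvd_imp_le_int[OF _ that] by (simp add: d_def)
    then have "d = -4 \<or> d = -3 \<or> d = -2 \<or> d = -1 \<or> d = 0 \<or> d = 1 \<or> d = 2 \<or> d = 3 \<or> d = 4"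
      by presburger
    moreover have "c = s + d" "d dvd 4" using that by (simp_all add: d_def)
    ultimately show ?thesis by auto
  qed
  show "c \<in> {s - 5, s - 1, s + 1, s + 5}" if "c - s dvd 5"
  proof -
    define d where "d = c - s"
    have "\<bar>d\<bar> \<le> 5" using dvd_imp_le_int[OF _ that] by (simp add: d_def)
    then have "d = -5 \<or> d = -4 \<or> d = -3 \<or> d = -2 \<or> d = -1 \<or> d = 0 \<or> d = 1 \<or> d = 2 \<or> d = 3 \<or> d = 4 \<or> d = 5"
      by presburger
    moreover have "c = s + d" "d dvd 5" using that by (simp_all add: d_def)
    ultimately show ?thesis by auto
  qed
qed

section \<open>Length bounds when the first step is 1\<close>

text \<open>The start \<open>s\<close> belongs to an orbit whose first step is \<open>+1\<close>: for \<open>s < 0\<close> it moves towards zero.\<close>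

definition length_bound :: "int \<Rightarrow> nat \<Rightarrow> bool" where
  "length_bound s n \<longleftrightarrow> (s < 0 \<longrightarrow> int n \<le> - s) \<and>
     (s > 0 \<longrightarrow> int n \<le> s + 2 \<and> (s \<ge> 3 \<longrightarrow> int n \<le> s))"

text \<open>The tail from index \<open>k\<close>, divided by its first step \<open>m\<close>, starts
  at \<open>b\<close>. A large \<open>\<bar>m\<bar>\<close> makes \<open>b\<close> small, which pays
  for the \<open>k\<close> terms cut off.\<close>

lemma hits_zero_bound_step:
  assumes h: "hits_zero a n" and k: "1 \<le> k" "k < n"
    and ap: "\<And>i. i \<le> k \<Longrightarrow> a i = a 0 + int i"
    and m: "m = a (Suc k) - a k" "m \<noteq> 1"
    and sb: "a 0 + int k = m * b"
    and IH: "length_bound b (n - k)"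
  shows "length_bound (a 0) n"
proof -
  define s where "s = a 0"
  define c where "c = a (n - 1)"
  have ap': "a i = s + int i" if "i \<le> k" for i using ap[OF that] by (simp add: s_def)
  have a1: "a 1 = s + 1" and ak: "a k = s + int k" and ak1: "a (Suc k) = s + int k + m"
    using ap' k m by auto
  have e: "s + int k = m * b" using sb by (simp add: s_def)
  have m0: "m \<noteq> 0" using hits_zero_distinct[OF h, of k "Suc k"] k m by simp
  \<comment> \<open>A step -1 after a step 1 would return to \<open>a (k - 1)\<close>.\<close>
  have m1: "m \<noteq> -1"
    using hits_zero_distinct[OF h, of "k - 1" "Suc k"] ap'[of "k - 1"] k ak1
    by (auto simp: less_Suc_eq_le)
  have s0: "s \<noteq> 0" using hits_zeroD(3)[OF h, of 0] k by (simp add: s_def)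
  \<comment> \<open>Compare \<open>a k\<close> with the term \<open>j\<close> places earlier: the
    difference is \<open>j\<close>, and the successors differ by \<open>m - 1 + j\<close>.\<close>
  have jdvd: "int j dvd m - 1" if "1 \<le> j" "j \<le> k" for j
  proof -
    have "a k - a (k - j) dvd a (Suc k) - a (Suc (k - j))"
      using hits_zeroD(4)[OF h] k by simp
    moreover have "a (Suc (k - j)) = s + int k - int j + 1"
      using ap'[of "Suc (k - j)"] that by simp
    ultimately have "int j dvd (m - 1) + int j"
      using ap'[of k] ap'[of "k - j"] ak1 that by (simp add: algebra_simps)
    then show ?thesis by simp
  qed
  \<comment> \<open>The successor of \<open>c\<close> is \<open>a n = 0\<close>.\<close>
  have c_dvd: "c - a i dvd a (Suc i)" if "Suc i < n" for i
    using hits_zeroD(4)[OF h, of "n - 1" i] hits_zeroD(2)[OF h] that by (simp add: c_def)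
  have c_neq: "c \<noteq> a i" if "Suc i < n" for i
    using hits_zero_distinct[OF h, of i "n - 1"] that
    by (auto simp: c_def less_diff_conv)
  have c0: "c \<noteq> 0" using hits_zeroD(3)[OF h, of "n - 1"] k by (simp add: c_def)
  have cs: "c - s dvd s + 1" using c_dvd[of 0] a1 k by (simp add: s_def)
  note hk = hits_zero_shift[OF h k(2)]
  have m_dvd: "m dvd a i" if "k \<le> i" "i \<le> n" for i
    using first_step_dvd[OF hk, of "i - k"] m that by simp
  have mc: "m dvd c" using m_dvd[of "n - 1"] k by (simp add: c_def)
  have IHn: "b < 0 \<Longrightarrow> int n - int k \<le> - b"
    and IHp: "b > 0 \<Longrightarrow> int n - int k \<le> b + 2"
    and IHp3: "b \<ge> 3 \<Longrightarrow> int n - int k \<le> b"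
    using IH k by (auto simp: length_bound_def of_nat_diff)
  consider "s < 0" | "s > 0" using s0 by linarith
  then have "length_bound s n"
  proof cases
    case 1
    \<comment> \<open>Otherwise the unit steps would reach 0 at index
      \<open>- s \<le> k < n\<close>.\<close>
    have neg: "s + int k < 0"
    proof (rule ccontr)
      assume "\<not> s + int k < 0"
      then have "nat (- s) \<le> k" by linarith
      then show False using ap'[of "nat (- s)"] hits_zeroD(3)[OF h, of "nat (- s)"] k 1 by simp
    qed
    have "int n \<le> - s"
    proof (cases "m > 0")
      case True
      then have "b < 0" using neg e by (simp add: mult_less_0_iff)
      moreover have "m * b \<le> 1 * b" using True \<open>b < 0\<close> by (intro mult_right_mono_neg) auto
      ultimately show ?thesis using IHn e by linarith
    next
      case False
      then have m2: "m \<le> -2" using m0 m1 by linarith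
      then have b: "b > 0" using neg e by (simp add: mult_less_0_iff)
      have "m * b \<le> -2 * b" using m2 b by (intro mult_right_mono) auto
      consider "b \<ge> 2" | "b = 1" "m \<le> -3" | "b = 1" "m = -2" using b m2 by linarith
      then show ?thesis
      proof cases
        case 1
        then show ?thesis using \<open>m * b \<le> -2 * b\<close> IHp IHp3 e by linarith
      next
        case 2
        then show ?thesis using IHp e by simp
      next
        case 3
        \<comment> \<open>The induction bound is one too large here. The only critical start is -3,
          where \<open>c\<close> must be -2 or -4, both already visited.\<close>
        show ?thesis
        proof (rule ccontr)
          assume "\<not> ?thesis"
          then have n: "n = k + 3" using IHp e 3 by simp
          have "k = 1" using jdvd[of 2] 3 k by fastforce
          then have "s = -3" using e 3 by simp
          then have "c \<in> {-5,-4,-2,-1}" using diff_dvd_int_cases(1)[of c s] cs by auto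
          moreover have "2 dvd c" using mc 3 by simp
          ultimately show False
            using c_neq[of 1] c_neq[of 2] a1 ak1 \<open>k = 1\<close> \<open>s = -3\<close> n 3 by (auto simp: numeral_2_eq_2)
        qed
      qed
    qed
    then show ?thesis using 1 by (simp add: length_bound_def)
  next
    case 2
    have pos: "m * b > 0" using 2 e by simp
    \<comment> \<open>As \<open>m\<close> and \<open>b\<close> have the same sign, absolute values
      treat both signs at once; the surplus 2 in the bound arises only for
      \<open>m > 0\<close>.\<close>
    define M f where "M = \<bar>m\<bar>" and "f = \<bar>b\<bar>"
    have M2: "M \<ge> 2" using m0 m1 m(2) by (auto simp: M_def)
    have f1: "f \<ge> 1" using pos by (cases "b = 0") (auto simp: f_def)
    have eM: "s + int k = M * f" using pos e by (simp add: M_def f_def flip: abs_mult)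
    have sgn: "m < 0 \<Longrightarrow> b < 0" "m > 0 \<Longrightarrow> b > 0" using pos by (auto simp: zero_less_mult_iff)
    have bn: "m < 0 \<Longrightarrow> int n \<le> int k + f" using IHn sgn by (simp add: f_def)
    have bp: "m > 0 \<Longrightarrow> int n \<le> int k + f + 2" "m > 0 \<Longrightarrow> f \<ge> 3 \<Longrightarrow> int n \<le> int k + f"
      using IHp IHp3 sgn by (auto simp: f_def)
    \<comment> \<open>If \<open>c = m\<close>, the step to \<open>c\<close> is \<open>\<plusminus>m\<close>, so the term before \<open>c\<close> is \<open>0\<close> or \<open>2m = a\<^sub>k\<close>.\<close>
    have c_tail: "c \<noteq> m" if "b = 2" "k + 2 \<le> n"
    proof
      assume cm: "c = m"
      define l where "l = n - 2"
      have l: "n = Suc (Suc l)" "k \<le> l" using that by (auto simp: l_def)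
      have "c - a l dvd c"
        using hits_zeroD(4)[OF h, of "Suc l" l] hits_zeroD(2)[OF h] l by (simp add: c_def)
      moreover obtain t where t: "a l = m * t" using m_dvd[of l] l by auto
      ultimately have "m * (1 - t) dvd m * 1" using cm by (simp add: algebra_simps)
      then have "1 - t dvd 1" using m0 by simp
      moreover have "t \<noteq> 0" using hits_zeroD(3)[OF h, of l] l t by auto
      ultimately have "t = 2" by (auto simp: zdvd1_eq)
      then have "a l = a k" using t ak e that by simp
      then have "l = k" using hits_zero_distinct[OF h, of k l] l by (cases "l = k") auto
      then have "c = m * 2 + m" using ak1 e that l by (simp add: c_def)
      then show False using cm m0 by simp
    qed
    have f_lt3: "f < 3 \<Longrightarrow> m > 0 \<Longrightarrow> (f = 1 \<and> s + int k = m) \<or> (f = 2 \<and> b = 2 \<and> s + int k = 2 * m)"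
      using f1 sgn e unfolding f_def by (cases "b = 1"; cases "b = 2") auto
    \<comment> \<open>A longer run forces a larger \<open>M\<close>: at least 2, 3, 5 and
      \<open>3 * k - 1\<close> in the four cases.\<close>
    consider "k = 1" | "k = 2" | "k = 3" | "k \<ge> 4" using k by linarith
    then have "int n \<le> s + 2 \<and> (s \<ge> 3 \<longrightarrow> int n \<le> s)"
    proof cases
      case 1
      have "2 * f \<le> M * f" using M2 f1 by (intro mult_right_mono) auto
      then have "2 * f \<le> s + 1" using eM 1 by simp
      then have easy: ?thesis if "int n \<le> 1 + f" using that \<open>s > 0\<close> by linarith
      show ?thesis
      proof (cases "m < 0 \<or> f \<ge> 3")
        case True
        then show ?thesis using easy bn bp 1 m0 by force
      next
        case False
        then have mp: "m \<ge> 2" using m0 m(2) by linarith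
        consider "f = 1" "s = m - 1" | "f = 2" "b = 2" "s = 2 * m - 1"
          using f_lt3 False mp 1 by auto
        then show ?thesis
        proof cases
          case 1
          \<comment> \<open>The bound 4 is too weak only for \<open>s = 1\<close> and
            \<open>s = 3\<close>; there the sole candidate is \<open>c = a 1\<close>.\<close>
          have "int n \<le> 3" if "m = 2 \<or> m = 4"
          proof (rule ccontr)
            assume "\<not> ?thesis"
            then have n: "n \<ge> 4" by linarith
            show False using that
            proof
              assume "m = 2"
              then show False using diff_dvd_int_cases(1)[of c s] 1 cs mc c0 c_neq[of 1] a1 n by auto
            next
              assume "m = 4"
              then show False using diff_dvd_int_cases(2)[of c s] 1 cs mc c0 c_neq[of 1] a1 n by auto
            qed
          qed
          moreover have "m = 2 \<or> m = 3 \<or> m = 4 \<or> m \<ge> 5" using mp by linarith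
          ultimately show ?thesis using bp(1) mp 1 c0 \<open>k = 1\<close> by auto
        next
          case 2
          \<comment> \<open>For \<open>s = 3\<close> the candidates are \<open>c = 4\<close>, which
            is \<open>a 1\<close>, and \<open>c = 2\<close>, which is \<open>m\<close> and falls to
            \<open>c_tail\<close>.\<close>
          have "int n \<le> 3" if "m = 2"
          proof (rule ccontr)
            assume "\<not> ?thesis"
            then have n: "n \<ge> 4" by linarith
            have "c \<in> {s - 4, s - 2, s - 1, s + 1, s + 2, s + 4}" using diff_dvd_int_cases(2)[of c s] cs that 2 by simp
            then show False
              using that 2 mc c_neq[of 1] a1 n c_tail \<open>k = 1\<close> by auto
          qed
          then show ?thesis using bp(1) mp 2 \<open>k = 1\<close> by (cases "m = 2") auto
        qed
      qed
    next
      case 2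
      have odd: "2 dvd m - 1" using jdvd[of 2] 2 by simp
      have M3: "M \<ge> 3" using odd M2 unfolding M_def by presburger
      have a2: "a 2 = s + 2" using ak 2 by simp
      have "3 * f \<le> M * f" using M3 f1 by (intro mult_right_mono) auto
      then have "3 * f \<le> s + 2" using eM 2 by simp
      then have easy: ?thesis if "int n \<le> 2 + f" using that \<open>s > 0\<close> by linarith
      show ?thesis
      proof (cases "m < 0 \<or> f \<ge> 3")
        case True
        then show ?thesis using easy bn bp 2 m0 by force
      next
        case False
        then have mp: "m \<ge> 3" using M3 by (simp add: M_def)
        consider "f = 1" "s = m - 2" | "f = 2" "b = 2" "s = 2 * m - 2"
          using f_lt3 False mp 2 by auto
        then show ?thesis
        proof cases
          case 1
          \<comment> \<open>Again \<open>s\<close> is 1 or 3, and the sole candidate is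
            \<open>c = a 2\<close>.\<close>
          have "int n \<le> 3" if "m = 3 \<or> m = 5"
          proof (rule ccontr)
            assume "\<not> ?thesis"
            then have n: "n \<ge> 4" by linarith
            show False using that
            proof
              assume "m = 3"
              then show False using diff_dvd_int_cases(1)[of c s] 1 cs mc c0 c_neq[of 2] a2 n by auto
            next
              assume "m = 5"
              then show False using diff_dvd_int_cases(2)[of c s] 1 cs mc c0 c_neq[of 2] a2 n by auto
            qed
          qed
          moreover have "m = 3 \<or> m = 5 \<or> m \<ge> 7" using mp odd by presburger
          ultimately show ?thesis using bp(1) mp 1 \<open>k = 2\<close> by auto
        next
          case 2
          \<comment> \<open>For \<open>s = 4\<close> the candidates are \<open>c = 9\<close>, which
            is \<open>a 3\<close>, and \<open>c = 3\<close>, which is \<open>m\<close>.\<close>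
          have "int n \<le> 4" if "m = 3"
          proof (rule ccontr)
            assume "\<not> ?thesis"
            then have n: "n \<ge> 5" by linarith
            have "c \<in> {s - 5, s - 1, s + 1, s + 5}" using diff_dvd_int_cases(3)[of c s] cs that 2 by simp
            moreover have "c \<noteq> 9" using c_neq[of 3] ak1 n that 2 \<open>k = 2\<close> by (simp add: numeral_3_eq_3)
            ultimately show False
              using that 2 mc n c_tail \<open>k = 2\<close> by auto
          qed
          then show ?thesis using bp(1) mp 2 \<open>k = 2\<close> by (cases "m = 3") auto
        qed
      qed
    next
      case 3
      have d: "2 dvd m - 1" "3 dvd m - 1" using jdvd[of 2] jdvd[of 3] 3 by simp_all
      have M5: "M \<ge> 5" "odd M" and m7: "m > 0 \<Longrightarrow> m \<ge> 7"
        using d M2 m(2) unfolding M_def by presburger+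
      have M5f: "5 * f \<le> s + 3" using mult_right_mono[of 5 M f] M5 f1 eM 3 by simp
      show ?thesis
      proof (cases "m < 0")
        case True
        \<comment> \<open>The estimate fails only at \<open>s = 3\<close>, which would need the even
          value \<open>M = 6\<close>.\<close>
        have "s \<noteq> 3"
        proof
          assume "s = 3"
          then have "f = 1" using M5f f1 by linarith
          then show False using eM \<open>s = 3\<close> 3 M5 by simp
        qed
        then show ?thesis using bn[OF True] M5f 3 \<open>s > 0\<close> f1 by linarith
      next
        case False
        then have mp: "m > 0" using m0 by simp
        then have "M = m" by (simp add: M_def)
        have f7: "7 * f \<le> s + 3"
          using mult_right_mono[of 7 M f] m7 mp f1 eM 3 \<open>M = m\<close> by simp
        consider "s \<ge> 7" | "f = 1" "s = 4" | "f = 1" "s = 5 \<or> s = 6" using f7 f1 by linarith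
        then show ?thesis
        proof cases
          case 1
          then show ?thesis using bp(1) mp f7 3 by linarith
        next
          case 2
          then have "m = 7" using eM \<open>M = m\<close> 3 by simp
          \<comment> \<open>No candidate for \<open>c\<close> is a multiple of 7, so this case is
            impossible.\<close>
          then show ?thesis using diff_dvd_int_cases(3)[of c s] cs mc 2 by auto
        next
          case A: 3
          then have "m = 8 \<or> m = 9" using eM \<open>M = m\<close> 3 by auto
          then show ?thesis using d by auto
        qed
      qed
    next
      case 4
      \<comment> \<open>The coprime divisors \<open>k\<close> and \<open>k - 1\<close> give
        \<open>\<bar>m - 1\<bar> \<ge> 3 * k\<close>, enough to absorb even the surplus 2.\<close>
      have "int k dvd m - 1" "int (k - 1) dvd m - 1"
        using jdvd[of k] jdvd[of "k - 1"] 4 by simp_all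
      moreover have "coprime (int k) (int (k - 1))"
        using 4 by (cases k) (simp_all del: of_nat_Suc)
      ultimately have "int k * int (k - 1) dvd m - 1" by (rule divides_mult)
      then have "int k * int (k - 1) \<le> \<bar>m - 1\<bar>"
        using m(2) zdvd_imp_le[of "int k * int (k - 1)" "\<bar>m - 1\<bar>"] by simp
      moreover have "int k * 3 \<le> int k * int (k - 1)" using 4 by (intro mult_left_mono) auto
      ultimately have M3: "M \<ge> 3 * int k - 1" by (simp add: M_def)
      have "(3 * int k - 1) * f \<le> M * f" using M3 f1 by (intro mult_right_mono) auto
      moreover have "(3 * int k - 2) * 1 \<le> (3 * int k - 2) * f" using f1 4 by (intro mult_left_mono) auto
      ultimately have "int k + f + 2 \<le> s" using eM 4 by (simp add: algebra_simps)
      then show ?thesis using bn bp m0 by linarith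
    qed
    then show ?thesis using 2 by (simp add: length_bound_def)
  qed
  then show ?thesis by (simp add: s_def)
qed

text \<open>Strong induction on \<open>n\<close>: cut at the first step other than 1. The first step
  is 1, so the tail is shorter.\<close>

lemma hits_zero_length_bound:
  assumes "hits_zero a n" "a 1 = a 0 + 1"
  shows "length_bound (a 0) n"
  using assms
proof (induction n arbitrary: a rule: less_induct)
  case (less n a)
  note h = less.prems(1)
  show ?case
  proof (cases "\<forall>i<n. a (Suc i) = a i + 1")
    case True
    have "a i = a 0 + int i" if "i \<le> n" for i
      using that by (induction i) (use True in auto)
    from this[of n] have "a 0 = - int n" using hits_zeroD(2)[OF h] by simp
    then show ?thesis by (simp add: length_bound_def)
  next
    case False
    define P where "P i \<longleftrightarrow> i < n \<and> a (Suc i) \<noteq> a i + 1" for i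
    define k where "k = (LEAST i. P i)"
    have "\<exists>i. P i" using False by (auto simp: P_def)
    then have "P k" unfolding k_def by (rule LeastI_ex)
    then have k: "k < n" "a (Suc k) \<noteq> a k + 1" by (auto simp: P_def)
    have k1: "1 \<le> k" using k less.prems(2) by (cases k) auto
    have lt: "a (Suc i) = a i + 1" if "i < k" for i
      using not_less_Least[of i P] that k by (auto simp: P_def k_def)
    have ap: "a i = a 0 + int i" if "i \<le> k" for i
      using that by (induction i) (use lt in auto)
    define m where "m = a (Suc k) - a k"
    have "m = (\<lambda>i. a (k + i)) 1 - (\<lambda>i. a (k + i)) 0" by (simp add: m_def)
    note d = hits_zero_div[OF hits_zero_shift[OF h k(1)] this]
    have "length_bound (a k div m) (n - k)"
      using less.IH[OF _ d(2,3)] k k1 by simp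
    moreover have "a 0 + int k = m * (a k div m)" using d(4) ap[of k] by simp
    moreover have "m \<noteq> 1" using k by (simp add: m_def)
    ultimately show ?thesis
      using hits_zero_bound_step[OF h k1 k(1) ap m_def] by blast
  qed
qed

text \<open>Dividing by the first step \<open>m\<close> gives
  \<open>\<bar>a 0\<bar> = \<bar>m\<bar> * \<bar>b\<bar>\<close>. When
  \<open>\<bar>b\<bar> \<le> 2\<close>, the surplus 2 is absorbed by
  \<open>\<bar>m\<bar> \<ge> 2\<close>.\<close>

lemma hits_zero_bound:
  assumes h: "hits_zero a n"
  shows "int n \<le> \<bar>a 0\<bar> + 2" "\<bar>a 0\<bar> \<ge> 3 \<Longrightarrow> int n \<le> \<bar>a 0\<bar>"
proof -
  define m where "m = a 1 - a 0"
  define b where "b = a 0 div m"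
  note d = hits_zero_div[OF h m_def]
  have lb: "length_bound b n" using hits_zero_length_bound[OF d(2,3)] by (simp add: b_def)
  have ab: "\<bar>a 0\<bar> = \<bar>m\<bar> * \<bar>b\<bar>" using d(4) by (simp add: b_def flip: abs_mult)
  have "b \<noteq> 0" using d(4) hits_zeroD(1,3)[OF h] by (auto simp: b_def)
  then have n: "int n \<le> \<bar>b\<bar> + 2" "\<bar>b\<bar> \<ge> 3 \<Longrightarrow> int n \<le> \<bar>b\<bar>"
    using lb by (auto simp: length_bound_def)
  have "1 * \<bar>b\<bar> \<le> \<bar>m\<bar> * \<bar>b\<bar>" using d(1) by (intro mult_right_mono) auto
  then show "int n \<le> \<bar>a 0\<bar> + 2" using n ab by linarith
  assume a3: "\<bar>a 0\<bar> \<ge> 3"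
  show "int n \<le> \<bar>a 0\<bar>"
  proof (cases "\<bar>m\<bar> = 1 \<or> \<bar>b\<bar> \<ge> 3")
    case True
    then show ?thesis using n ab a3 \<open>1 * \<bar>b\<bar> \<le> \<bar>m\<bar> * \<bar>b\<bar>\<close> by auto
  next
    case False
    then have "\<bar>m\<bar> \<ge> 2" "\<bar>b\<bar> = 1 \<or> \<bar>b\<bar> = 2" using d(1) \<open>b \<noteq> 0\<close> by linarith+
    then show ?thesis using n ab a3 by auto
  qed
qed

section \<open>Polynomial orbits and the start at zero\<close>

lemma poly_diff_dvd:
  fixes u :: "'a::comm_ring_1 poly"
  shows "x - y dvd poly u x - poly u y"
proof (induction u)
  case (pCons c u)
  have "poly (pCons c u) x - poly (pCons c u) y = x * (poly u x - poly u y) + (x - y) * poly u y"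
    by (simp add: algebra_simps)
  then show ?case using pCons by (simp add: dvd_add)
qed simp

lemma zero_periodic_index_le_2:
  fixes u :: "int poly"
  assumes "n \<ge> 1" "(poly u ^^ n) 0 = 0"
  shows "(poly u ^^ 2) 0 = 0"
proof (rule ccontr)
  assume ne: "(poly u ^^ 2) 0 \<noteq> 0"
  define a where "a i = (poly u ^^ i) 0" for i
  define d where "d i = a (Suc i) - a i" for i
  have per: "a (i + n * t) = a i" for i t
  proof (induction t)
    case (Suc t)
    have "i + n * Suc t = (i + n * t) + n" by simp
    then have "a (i + n * Suc t) = (poly u ^^ (i + n * t)) ((poly u ^^ n) 0)"
      by (simp only: a_def funpow_add o_apply)
    then show ?case using assms Suc by (simp add: a_def)
  qed simp
  have d_dvd: "d i dvd d (i + t)" for i t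
  proof (induction t)
    case (Suc t)
    have "d (i + t) dvd d (Suc (i + t))"
      using poly_diff_dvd[of "a (Suc (i + t))" "a (i + t)" u] by (simp add: d_def a_def)
    then show ?case using Suc by (simp add: dvd_trans)
  qed simp
  have d_eq: "d (Suc i) = d i" for i
  proof -
    \<comment> \<open>Going once around the period leads from step \<open>Suc i\<close> back to step
      \<open>i\<close>, so divisibility holds both ways.\<close>
    have "d (Suc i) dvd d (Suc i + (n - 1))" by (rule d_dvd)
    also have "d (Suc i + (n - 1)) = d i" using assms per[of i 1] per[of "Suc i" 1] by (simp add: d_def)
    finally have "d (Suc i) dvd d i" .
    then have "\<bar>d (Suc i)\<bar> = \<bar>d i\<bar>" using d_dvd[of i 1] by (intro zdvd_antisym_abs) simp_all
    moreover have "d (Suc i) \<noteq> - d i"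
    proof
      assume "d (Suc i) = - d i"
      then have "a (Suc (Suc i)) = a i" by (simp add: d_def)
      have shift: "a (t + j) = (poly u ^^ t) (a j)" for t j
        by (simp add: a_def funpow_add)
      have "i \<le> n * i" using assms by simp
      \<comment> \<open>Push the coincidence forward from index \<open>i\<close> to the multiple
        \<open>n * i\<close> of the period, where the orbit is at 0; this gives
        \<open>a 2 = 0\<close>.\<close>
      then have "a (n * i + 2) = a ((n * i - i) + Suc (Suc i))" by simp
      also have "\<dots> = a ((n * i - i) + i)"
        by (simp only: shift \<open>a (Suc (Suc i)) = a i\<close>)
      also have "\<dots> = a (0 + n * i)" using \<open>i \<le> n * i\<close> by simp
      also have "\<dots> = 0" by (simp only: per) (simp add: a_def)
      finally show False using per[of 2 i] ne by (simp add: a_def add.commute)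
    qed
    ultimately show ?thesis by linarith
  qed
  have "d i = d 0" for i by (induction i) (simp_all add: d_eq)
  then have step: "a (Suc i) = a i + d 0" for i by (metis d_def diff_add_cancel add.commute)
  have "a i = int i * d 0" for i
  proof (induction i)
    case (Suc i)
    then show ?case using step[of i] by (simp add: algebra_simps)
  qed (simp add: a_def)
  \<comment> \<open>\<open>a n = 0\<close> forces \<open>d 0 = 0\<close>, hence
    \<open>a 2 = 0\<close>.\<close>
  from this[of n] this[of 2] show False using assms ne by (simp add: a_def)
qed

theorem theorem1p5:
  fixes r :: int and u :: "int poly"
  assumes "nilpotent_at u r"
  shows "int (nilpotency_index u r) \<le> \<bar>r\<bar> + 2 \<and>
         (\<bar>r\<bar> \<ge> 3 \<longrightarrow> int (nilpotency_index u r) \<le> \<bar>r\<bar>)"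
proof -
  define a where "a i = (poly u ^^ i) r" for i
  define n where "n = nilpotency_index u r"
  have n_def': "n = (LEAST n. n \<ge> 1 \<and> a n = 0)"
    by (simp add: n_def nilpotency_index_def a_def poly_poly_iter)
  have ex: "\<exists>n\<ge>1. a n = 0"
    using assms by (simp add: nilpotent_at_def a_def poly_poly_iter)
  then have n: "n \<ge> 1" "a n = 0"
    using LeastI_ex[of "\<lambda>n. n \<ge> 1 \<and> a n = 0"] by (auto simp: n_def')
  have least: "n \<le> i" if "i \<ge> 1" "a i = 0" for i
    unfolding n_def' by (rule Least_le) (use that in simp)
  \<comment> \<open>The start 0 is separate because \<open>hits_zero\<close> demands a nonzero
    \<open>a 0\<close>.\<close>
  show ?thesis
  proof (cases "r = 0")
    case True
    then have "a 2 = 0" using zero_periodic_index_le_2[of n u] n by (simp add: a_def)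
    then have "n \<le> 2" using least by simp
    then show ?thesis unfolding n_def[symmetric] using True by simp
  next
    case False
    have "a i \<noteq> 0" if "i < n" for i
      using least[of i] that False by (cases i) (auto simp: a_def)
    moreover have "a i - a j dvd a (Suc i) - a (Suc j)" for i j
      using poly_diff_dvd by (simp add: a_def)
    ultimately have "hits_zero a n" using n by (simp add: hits_zero_def)
    from hits_zero_bound[OF this] show ?thesis by (simp add: a_def flip: n_def)
  qed
qed

end
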